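(* Let $Y$ be a Poisson random variable with parameter $\alpha>0$. For all integers $n\ge 0$, $$H_{n,\lambda}^{Y}(x)=\sum_{k=0}^{n}\phi_{k}(x)H_{\lambda}(n,k)\alpha^{k}.$$
   Context: Fix a nonzero real $\lambda$. Put $\langle x\rangle_{0,\lambda}=1$, $\langle x\rangle_{n,\lambda}=x(x+\lambda)\cdots(x+(n-1)\lambda)$, and for real $a$ let $e_\lambda^{-a}(-t)=(1-\lambda t)^{-a/\lambda}=\sum_{n\ge0}\langle a\rangle_{n,\lambda}t^n/n!$. The probabilistic heterogeneous Bell polynomials associated with $Y$ are defined by $e^{x(E[e_{\lambda}^{-Y}(-t)]-1)}=\sum_{n\ge0}H_{n,\lambda}^{Y}(x)t^{n}/n!$. The heterogeneous Stirling numbers of the second kind $H_\lambda(n,k)$ are defined by $\frac{1}{k!}(e_{\lambda}^{-1}(-t)-1)^{k}=\sum_{n\ge k}H_{\lambda}(n,k)\frac{t^{n}}{n!}$ (equivalently $\langle x\rangle_{n,\lambda}=\sum_{k=0}^nH_\lambda(n,k)x(x-1)\cdots(x-k+1)$). The Bell polynomials $\phi_k(x)$ are defined by $e^{x(e^{t}-1)}=\sum_{n\ge0}\phi_{n}(x)\frac{t^{n}}{n!}$. *)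

theory Defs
  imports "HOL-Probability.Probability"
begin

text \<open>
  Coefficients of an exponential generating function: a function \<open>f\<close> that is analytic at \<open>0\<close>
  satisfies \<open>f t = (\<Sum>n. egf_coeff f n * t ^ n / fact n)\<close> for all \<open>t\<close> near \<open>0\<close>. The value is
  unspecified if \<open>f\<close> has no power series expansion at \<open>0\<close>.
\<close>
definition egf_coeff :: "(real \<Rightarrow> real) \<Rightarrow> nat \<Rightarrow> real" where
  "egf_coeff f n = fact n * fps_nth (THE F. f has_fps_expansion F) n"

lemma egf_coeff_eq:
  assumes "f has_fps_expansion F"
  shows "egf_coeff f n = fact n * fps_nth F n"
proof -
  have "G = F" if "f has_fps_expansion G" for G
  proof (rule ccontr)
    assume "G \<noteq> F"
    define D where "D = G - F"
    define n where "n = subdegree D"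
    have D: "(\<lambda>_. 0) has_fps_expansion D"
      using has_fps_expansion_diff[OF that assms] by (simp add: D_def)
    have Dn: "fps_nth D n \<noteq> 0"
      unfolding n_def using \<open>G \<noteq> F\<close> by (intro nth_subdegree_nonzero) (simp add: D_def)
    have "(\<lambda>x. if x = 0 then fps_nth D n else 0 / x ^ n) has_fps_expansion fps_shift n D"
      using D by (intro has_fps_expansion_shift) (auto simp: n_def)
    then have "continuous (at 0) (\<lambda>x. if x = 0 then fps_nth D n else 0 / x ^ n)"
      by (rule has_fps_expansion_imp_continuous)
    then have "((\<lambda>x. if x = 0 then fps_nth D n else 0 / x ^ n) \<longlongrightarrow> fps_nth D n) (at 0)"
      by (simp add: continuous_at)
    moreover have "((\<lambda>x. if x = 0 then fps_nth D n else 0 / x ^ n) \<longlongrightarrow> 0) (at 0)"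
      by (rule tendsto_eventually) (simp add: eventually_at_filter)
    ultimately have "fps_nth D n = 0"
      by (intro tendsto_unique[of "at (0::real)"]) auto
    with Dn show False by simp
  qed
  with assms have "(THE F. f has_fps_expansion F) = F"
    by (intro the_equality)
  then show ?thesis
    by (simp add: egf_coeff_def)
qed

text \<open>
  The degenerate exponential \<open>e\<^sub>l\<^sup>a(t) = (1 + l t)\<^bsup>a/l\<^esup>\<close>, meaningful for \<open>l \<noteq> 0\<close> and \<open>1 + l t > 0\<close>,
  in particular for all \<open>t\<close> near \<open>0\<close>.
\<close>
definition deg_exp :: "real \<Rightarrow> real \<Rightarrow> real \<Rightarrow> real" where
  "deg_exp l a t = (1 + l * t) powr (a / l)"

definition rising_fact :: "real \<Rightarrow> real \<Rightarrow> nat \<Rightarrow> real" where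
  "rising_fact l x n = (\<Prod>i<n. x + real i * l)"

lemma deg_exp_sums:
  assumes "l \<noteq> 0" "\<bar>l * t\<bar> < 1"
  shows "(\<lambda>n. rising_fact l a n * t ^ n / fact n) sums deg_exp l (- a) (- t)"
proof -
  have r: "rising_fact l a n = l ^ n * pochhammer (a / l) n" for n
  proof -
    have "l ^ n * pochhammer (a / l) n = (\<Prod>i<n. l * (a / l + real i))"
      by (simp add: pochhammer_prod prod.distrib atLeast0LessThan)
    also have "\<dots> = rising_fact l a n"
      unfolding rising_fact_def using assms(1) by (intro prod.cong) (auto simp: field_simps)
    finally show ?thesis by simp
  qed
  have "(- (a / l) gchoose n) * (- (l * t)) ^ n = rising_fact l a n * t ^ n / fact n" for n
  proof -
    have "(- 1) ^ n * (- (l * t)) ^ n = (l * t) ^ n"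
      by (simp flip: power_mult_distrib)
    then show ?thesis
      by (simp add: gbinomial_pochhammer r power_mult_distrib mult_ac)
  qed
  then show ?thesis
    using gen_binomial_real[of "- (l * t)" "- (a / l)"] assms(2) by (simp add: deg_exp_def)
qed

definition het_stirling :: "real \<Rightarrow> nat \<Rightarrow> nat \<Rightarrow> real" where
  "het_stirling l n k = egf_coeff (\<lambda>t. (deg_exp l (- 1) (- t) - 1) ^ k / fact k) n"

definition bell_poly :: "nat \<Rightarrow> real \<Rightarrow> real" where
  "bell_poly n x = egf_coeff (\<lambda>t. exp (x * (exp t - 1))) n"

definition prob_het_bell :: "'a measure \<Rightarrow> ('a \<Rightarrow> real) \<Rightarrow> real \<Rightarrow> nat \<Rightarrow> real \<Rightarrow> real" where
  "prob_het_bell M Y l n x =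
     egf_coeff (\<lambda>t. exp (x * ((\<integral>\<omega>. deg_exp l (- Y \<omega>) (- t) \<partial>M) - 1))) n"

definition poisson_rv :: "'a measure \<Rightarrow> real \<Rightarrow> ('a \<Rightarrow> real) \<Rightarrow> bool" where
  "poisson_rv M \<alpha> Y \<longleftrightarrow>
     Y \<in> borel_measurable M \<and> distr M borel Y = distr (measure_pmf (poisson_pmf \<alpha>)) borel real"

end

theory Submission
  imports Defs "HOL-Complex_Analysis.Laurent_Convergence"
begin

text \<open>
  Write \<open>u(t) = e\<^sub>l\<^bsup>-1\<^esup>(-t)\<close>. Near \<open>t = 0\<close> one has \<open>e\<^sub>l\<^bsup>-k\<^esup>(-t) = u(t)\<^sup>k\<close>, so \<open>E[e\<^sub>l\<^bsup>-Y\<^esup>(-t)]\<close>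
  is the probability generating function of the Poisson distribution at \<open>u(t)\<close>, namely
  \<open>exp (\<alpha> (u(t) - 1))\<close>. Hence the generating function of the probabilistic heterogeneous Bell
  polynomials is that of the Bell polynomials composed with \<open>\<alpha> (u(t) - 1)\<close>, a power series
  without constant term, and the claim is read off from the coefficients of the composition.
\<close>

text \<open>Real series are transported to complex ones so that the composition theorem for
  convergent power series can be applied over the complex numbers.\<close>

definition fps_complex_of_real :: "real fps \<Rightarrow> complex fps" where
  "fps_complex_of_real F = Abs_fps (\<lambda>n. complex_of_real (fps_nth F n))"

lemma fps_nth_complex_of_real [simp]:
  "fps_nth (fps_complex_of_real F) n = complex_of_real (fps_nth F n)"
  by (simp add: fps_complex_of_real_def)

lemma fps_complex_of_real_mult:
  "fps_complex_of_real (F * G) = fps_complex_of_real F * fps_complex_of_real G"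
  by (simp add: fps_eq_iff fps_mult_nth)

lemma fps_complex_of_real_power:
  "fps_complex_of_real (F ^ n) = fps_complex_of_real F ^ n"
proof (induction n)
  case 0
  show ?case by (simp add: fps_eq_iff)
next
  case (Suc n)
  then show ?case by (simp add: fps_complex_of_real_mult)
qed

lemma fps_complex_of_real_compose:
  "fps_complex_of_real (F oo G) = fps_complex_of_real F oo fps_complex_of_real G"
  by (simp add: fps_eq_iff fps_compose_nth flip: fps_complex_of_real_power)

lemma fps_conv_radius_complex_of_real [simp]:
  "fps_conv_radius (fps_complex_of_real F) = fps_conv_radius F"
proof -
  have "conv_radius (\<lambda>n. norm (fps_nth (fps_complex_of_real F) n)) =
        conv_radius (\<lambda>n. norm (fps_nth F n))"
    by simp
  then show ?thesis
    unfolding fps_conv_radius_def conv_radius_norm .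
qed

lemma eval_fps_complex_of_real:
  assumes "ereal \<bar>z\<bar> < fps_conv_radius F"
  shows "eval_fps (fps_complex_of_real F) (complex_of_real z) = complex_of_real (eval_fps F z)"
proof -
  have "(\<lambda>n. fps_nth F n * z ^ n) sums eval_fps F z"
    using assms by (intro sums_eval_fps) simp
  then have "(\<lambda>n. complex_of_real (fps_nth F n * z ^ n)) sums complex_of_real (eval_fps F z)"
    by (rule sums_of_real)
  then show ?thesis
    by (simp add: eval_fps_def sums_iff)
qed

lemma eventually_less_fps_conv_radius:
  fixes F :: "real fps"
  assumes "fps_conv_radius F > 0"
  shows "eventually (\<lambda>z. ereal \<bar>z\<bar> < fps_conv_radius F) (nhds 0)"
proof -
  have "eventually (\<lambda>z. z \<in> eball 0 (fps_conv_radius F)) (nhds (0::real))"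
    using assms by (intro eventually_nhds_in_open) (auto simp: zero_ereal_def)
  then show ?thesis
    by simp
qed

text \<open>The complex theorem supplies the positive radius of \<open>F oo G\<close> and the
  identity of sums near 0. On the real axis both sides are embedded reals, so the identity descends
  by injectivity of \<open>complex_of_real\<close>.\<close>

lemma has_fps_expansion_compose_real:
  fixes f g :: "real \<Rightarrow> real"
  assumes f: "f has_fps_expansion F" and g: "g has_fps_expansion G" and G0: "fps_nth G 0 = 0"
  shows "(\<lambda>t. f (g t)) has_fps_expansion (F oo G)"
proof -
  let ?c = fps_complex_of_real
  have rF: "fps_conv_radius F > 0" and rG: "fps_conv_radius G > 0"
    using f g by (auto simp: has_fps_expansion_def)
  have "(eval_fps (?c F) \<circ> eval_fps (?c G)) has_fps_expansion (?c F oo ?c G)"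
    using rF rG G0 by (intro has_fps_expansion_compose eval_fps_has_fps_expansion) simp_all
  then have "fps_conv_radius (?c (F oo G)) > 0" and
    ev: "eventually (\<lambda>z. eval_fps (?c (F oo G)) z = eval_fps (?c F) (eval_fps (?c G) z)) (nhds 0)"
    by (simp_all only: has_fps_expansion_def fps_complex_of_real_compose o_def)
  then have rFG: "fps_conv_radius (F oo G) > 0"
    by simp
  \<comment> \<open>Continuity of the embedding restricts the complex identity to real points near
    0.\<close>
  have "filterlim complex_of_real (nhds 0) (nhds 0)"
    using tendsto_of_real[OF filterlim_ident, of "0::real", where 'a = complex] by simp
  then have ev': "eventually (\<lambda>t. eval_fps (?c (F oo G)) (complex_of_real t) =
      eval_fps (?c F) (eval_fps (?c G) (complex_of_real t))) (nhds 0)"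
    using ev by (rule eventually_compose_filterlim[rotated])
  have "g 0 = 0"
    using has_fps_expansion_imp_0_eq_fps_nth_0[OF g] G0 by simp
  \<comment> \<open>The zero constant term makes \<open>g\<close> tend to 0, so whatever holds near
    0 also holds at \<open>g t\<close> for small \<open>t\<close>.\<close>
  then have lim: "filterlim g (nhds 0) (nhds 0)"
    using has_fps_expansion_imp_continuous[OF g, of UNIV] tendsto_at_iff_tendsto_nhds[of g 0]
    by (simp add: isCont_def)
  have fg: "eventually (\<lambda>t. eval_fps F (g t) = f (g t)) (nhds 0)"
    using f by (intro eventually_compose_filterlim[OF _ lim]) (simp add: has_fps_expansion_def)
  have Fg: "eventually (\<lambda>t. ereal \<bar>g t\<bar> < fps_conv_radius F) (nhds 0)"
    by (intro eventually_compose_filterlim[OF _ lim] eventually_less_fps_conv_radius rF)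
  have Gg: "eventually (\<lambda>t. eval_fps G t = g t) (nhds 0)"
    using g by (simp add: has_fps_expansion_def)
  have "eventually (\<lambda>t. eval_fps (F oo G) t = f (g t)) (nhds 0)"
    using ev' fg Fg Gg eventually_less_fps_conv_radius[OF rG] eventually_less_fps_conv_radius[OF rFG]
  proof eventually_elim
    case (elim t)
    then have "complex_of_real (eval_fps (F oo G) t) = complex_of_real (f (g t))"
      by (simp add: eval_fps_complex_of_real)
    then show ?case
      by (simp only: of_real_eq_iff)
  qed
  with rFG show ?thesis
    by (simp add: has_fps_expansion_def)
qed

lemma deg_exp_of_nat:
  assumes "l * t < 1"
  shows "deg_exp l (- real k) (- t) = deg_exp l (- 1) (- t) ^ k"
  using assms by (simp add: deg_exp_def powr_powr flip: powr_realpow)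

lemma eventually_abs_mult_less_1: "eventually (\<lambda>t::real. \<bar>l * t\<bar> < 1) (nhds 0)"
proof -
  have "((\<lambda>t. \<bar>l * t\<bar>) \<longlongrightarrow> \<bar>l * 0\<bar>) (nhds 0)"
    by (intro tendsto_intros filterlim_ident)
  then show ?thesis
    by (rule order_tendstoD) simp
qed

lemma deg_exp_has_fps_expansion:
  assumes "l \<noteq> 0"
  shows "(\<lambda>t. deg_exp l (- a) (- t)) has_fps_expansion Abs_fps (\<lambda>n. rising_fact l a n / fact n)"
proof (rule has_fps_expansionI)
  show "eventually (\<lambda>t. (\<lambda>n. fps_nth (Abs_fps (\<lambda>n. rising_fact l a n / fact n)) n * t ^ n)
          sums deg_exp l (- a) (- t)) (nhds 0)"
    using eventually_abs_mult_less_1[of l]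
    by eventually_elim (use deg_exp_sums[OF assms] in simp)
qed

text \<open>Weighting \<open>u ^ k\<close> by the Poisson mass gives \<open>exp (- \<alpha>)\<close>
  times the exponential series at \<open>\<alpha> * u\<close>, for \<open>u\<close> of either
  sign.\<close>

lemma expectation_power_poisson:
  fixes u :: real
  assumes "\<alpha> > 0"
  shows "(\<integral>k. u ^ k \<partial>measure_pmf (poisson_pmf \<alpha>)) = exp (\<alpha> * (u - 1))"
proof -
  let ?h = "\<lambda>k. \<alpha> ^ k / fact k * exp (- \<alpha>) * u ^ k"
  have h: "?h = (\<lambda>k. exp (- \<alpha>) * ((\<alpha> * u) ^ k /\<^sub>R fact k))"
    by (simp add: fun_eq_iff power_mult_distrib field_simps)
  \<comment> \<open>The absolute values again form an exponential series, now at
    \<open>\<alpha> * \<bar>u\<bar>\<close>; this gives integrability.\<close>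
  have "(\<lambda>k. norm (?h k)) = (\<lambda>k. exp (- \<alpha>) * ((\<alpha> * \<bar>u\<bar>) ^ k /\<^sub>R fact k))"
    using assms by (simp add: fun_eq_iff power_mult_distrib abs_mult power_abs field_simps)
  then have "integrable (count_space UNIV) ?h"
    by (simp only: integrable_count_space_nat_iff summable_mult summable_exp_generic)
  then have "?h sums (\<integral>k. ?h k \<partial>count_space UNIV)"
    by (rule sums_integral_count_space_nat)
  moreover have "?h sums (exp (- \<alpha>) * exp (\<alpha> * u))"
    unfolding h by (intro sums_mult exp_converges)
  ultimately have "(\<integral>k. ?h k \<partial>count_space UNIV) = exp (- \<alpha>) * exp (\<alpha> * u)"
    by (rule sums_unique2)
  moreover have "(\<integral>k. u ^ k \<partial>measure_pmf (poisson_pmf \<alpha>)) = (\<integral>k. ?h k \<partial>count_space UNIV)"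
    unfolding measure_pmf_eq_density using assms by (subst integral_density) simp_all
  ultimately show ?thesis
    by (simp add: algebra_simps flip: exp_add)
qed

text \<open>The expectation depends only on the law of \<open>Y\<close>. Moved to the Poisson law on
  the naturals, the integrand becomes a power of \<open>deg_exp l (- 1) (- t)\<close>.\<close>

lemma expectation_deg_exp_poisson:
  assumes "\<alpha> > 0" "poisson_rv M \<alpha> Y" "l * t < 1"
  shows "(\<integral>\<omega>. deg_exp l (- Y \<omega>) (- t) \<partial>M) = exp (\<alpha> * (deg_exp l (- 1) (- t) - 1))"
proof -
  have Y: "Y \<in> borel_measurable M"
    and distr: "distr M borel Y = distr (measure_pmf (poisson_pmf \<alpha>)) borel real"
    using assms(2) by (auto simp: poisson_rv_def)
  have meas: "(\<lambda>y. deg_exp l (- y) (- t)) \<in> borel_measurable borel"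
    unfolding deg_exp_def by measurable
  have "(\<integral>\<omega>. deg_exp l (- Y \<omega>) (- t) \<partial>M) = (\<integral>y. deg_exp l (- y) (- t) \<partial>distr M borel Y)"
    using Y meas by (rule integral_distr[symmetric])
  also have "\<dots> = (\<integral>k. deg_exp l (- real k) (- t) \<partial>measure_pmf (poisson_pmf \<alpha>))"
    unfolding distr using meas by (intro integral_distr) simp_all
  also have "\<dots> = exp (\<alpha> * (deg_exp l (- 1) (- t) - 1))"
    using assms by (simp add: deg_exp_of_nat expectation_power_poisson)
  finally show ?thesis .
qed

theorem theorem2p17:
  fixes M :: "'a measure" and Y :: "'a \<Rightarrow> real" and l \<alpha> x :: real and n :: nat
  assumes "prob_space M"
    and "l \<noteq> 0"
    and "\<alpha> > 0"
    and "poisson_rv M \<alpha> Y"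
  shows "prob_het_bell M Y l n x = (\<Sum>k=0..n. bell_poly k x * het_stirling l n k * \<alpha> ^ k)"
proof -
  define D where "D = Abs_fps (\<lambda>n. rising_fact l 1 n / fact n) - 1"
  define B where "B = fps_exp x oo (fps_exp 1 - 1)"
  have D: "(\<lambda>t. deg_exp l (- 1) (- t) - 1) has_fps_expansion D"
    unfolding D_def by (intro fps_expansion_intros deg_exp_has_fps_expansion assms)
  have D0: "fps_nth D 0 = 0"
    by (simp add: D_def rising_fact_def)
  have B: "(\<lambda>t. exp (x * (exp t - 1))) has_fps_expansion B"
    unfolding B_def by (intro has_fps_expansion_compose_real fps_expansion_intros) simp
  have "(\<lambda>t. exp (x * (exp (\<alpha> * (deg_exp l (- 1) (- t) - 1)) - 1)))
          has_fps_expansion (B oo (fps_const \<alpha> * D))"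
    using D0 by (intro has_fps_expansion_compose_real[OF B] fps_expansion_intros D) simp
  \<comment> \<open>The two functions need only agree near 0: \<open>\<bar>l * t\<bar> < 1\<close>
    keeps \<open>1 - l * t\<close> positive, and an expansion at 0 is a local property.\<close>
  moreover have "eventually (\<lambda>t. exp (x * (exp (\<alpha> * (deg_exp l (- 1) (- t) - 1)) - 1)) =
      exp (x * ((\<integral>\<omega>. deg_exp l (- Y \<omega>) (- t) \<partial>M) - 1))) (nhds 0)"
    using eventually_abs_mult_less_1[of l]
    by eventually_elim (simp add: expectation_deg_exp_poisson[OF assms(3,4)])
  ultimately have "(\<lambda>t. exp (x * ((\<integral>\<omega>. deg_exp l (- Y \<omega>) (- t) \<partial>M) - 1)))
      has_fps_expansion (B oo (fps_const \<alpha> * D))"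
    by (rule has_fps_expansion_cong[THEN iffD1, rotated 2]) simp
  then have "prob_het_bell M Y l n x = fact n * fps_nth (B oo (fps_const \<alpha> * D)) n"
    unfolding prob_het_bell_def by (rule egf_coeff_eq)
  \<comment> \<open>Coefficient \<open>n\<close> of a formal composition is a finite sum over
    \<open>k \<le> n\<close>, and \<open>\<alpha> ^ k\<close> comes out of the power of the inner
    series.\<close>
  also have "\<dots> = (\<Sum>k=0..n. fact n * (fps_nth B k * (\<alpha> ^ k * fps_nth (D ^ k) n)))"
    by (simp add: fps_compose_nth power_mult_distrib fps_const_power sum_distrib_left)
  also have "\<dots> = (\<Sum>k=0..n. bell_poly k x * het_stirling l n k * \<alpha> ^ k)"
  proof (intro sum.cong refl)
    fix k
    have S: "(\<lambda>t. 1 / fact k * (deg_exp l (- 1) (- t) - 1) ^ k)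
            has_fps_expansion (fps_const (1 / fact k) * D ^ k)"
      by (intro fps_expansion_intros D)
    have "het_stirling l n k = fact n * fps_nth (D ^ k) n / fact k"
      using egf_coeff_eq[OF S, of n] by (simp add: het_stirling_def)
    moreover have "bell_poly k x = fact k * fps_nth B k"
      unfolding bell_poly_def by (rule egf_coeff_eq[OF B])
    \<comment> \<open>The \<open>fact k\<close> from the Bell coefficient cancels the
      \<open>1 / fact k\<close> in the Stirling generating function.\<close>
    ultimately show "fact n * (fps_nth B k * (\<alpha> ^ k * fps_nth (D ^ k) n)) =
        bell_poly k x * het_stirling l n k * \<alpha> ^ k"
      by simp
  qed
  finally show ?thesis .
qed

end
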